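(* Let $n\ge5$ and let $L_n$ be the complex Lie algebra with basis $(e_1,\ldots,e_n)$ and Lie brackets $[e_1,e_i]=e_{i+1}$ for $2\le i\le n-1$ (all other brackets of basis vectors not obtained by skew-symmetry being zero). Every CPA-structure on $L_n$ is either of type 1, with products $$e_1\cdot e_1=\alpha_2e_2+\cdots+\alpha_ne_n,\quad e_1\cdot e_2=\beta e_{n-1}+\gamma e_n,\quad e_1\cdot e_3=\beta e_n,\quad e_2\cdot e_2=\delta e_n,$$ with arbitrary parameters $\alpha_2,\ldots,\alpha_n,\beta,\gamma,\delta\in\mathbb{C}$ satisfying $\alpha_2\delta+\beta=0$, or of type 2, with products $$e_1\cdot e_1=\alpha_2e_2+\cdots+\alpha_ne_n,\quad e_1\cdot e_2=e_3+\beta e_{n-1}+\gamma e_n,\quad e_1\cdot e_3=e_4+\beta e_n,$$ $$e_1\cdot e_k=e_{k+1}\ (4\le k\le n-1),\quad e_2\cdot e_2=\delta e_n,$$ with arbitrary parameters $\alpha_2,\ldots,\alpha_n,\beta,\gamma,\delta\in\mathbb{C}$ satisfying $\alpha_2\delta-\beta=0$; and all such choices of parameters do give CPA-structures on $L_n$. In both cases $[L_n,L_n]\cdot[L_n,L_n]=0$, but in general (i.e. for some choices of the parameters) $L_n\cdot[L_n,L_n]\neq0$, in each of the two types.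
   Context: A commutative post-Lie algebra structure (CPA-structure) on a Lie algebra $\mathfrak{g}=(V,[\,,])$ is a bilinear product $x\cdot y$ on $V$ such that for all $x,y,z\in V$: $x\cdot y=y\cdot x$; $[x,y]\cdot z=x\cdot(y\cdot z)-y\cdot(x\cdot z)$; $x\cdot[y,z]=[x\cdot y,z]+[y,x\cdot z]$. Products are listed only for $e_i\cdot e_j$ with $i\le j$; all products $e_i\cdot e_j$, $i\le j$, not listed are zero, and those with $i>j$ are determined by commutativity. *)

theory Defs
  imports Complex_Main
begin

definition bilinear_product ::
    "('k::field \<Rightarrow> 'v::ab_group_add \<Rightarrow> 'v) \<Rightarrow> ('v \<Rightarrow> 'v \<Rightarrow> 'v) \<Rightarrow> bool" where
  "bilinear_product scale f \<longleftrightarrow>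
     (\<forall>x. Vector_Spaces.linear scale scale (\<lambda>y. f x y)) \<and>
     (\<forall>y. Vector_Spaces.linear scale scale (\<lambda>x. f x y))"

locale lie_algebra = vector_space scale
  for scale :: "'k::field \<Rightarrow> 'v::ab_group_add \<Rightarrow> 'v" +
  fixes bracket :: "'v \<Rightarrow> 'v \<Rightarrow> 'v"
  assumes bracket_bilinear: "bilinear_product scale bracket"
    and bracket_alternating: "bracket x x = 0"
    and jacobi: "bracket x (bracket y z) + bracket y (bracket z x) + bracket z (bracket x y) = 0"

definition cpa_structure ::
    "('k::field \<Rightarrow> 'v::ab_group_add \<Rightarrow> 'v) \<Rightarrow> ('v \<Rightarrow> 'v \<Rightarrow> 'v) \<Rightarrow> ('v \<Rightarrow> 'v \<Rightarrow> 'v) \<Rightarrow> bool" where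
  "cpa_structure scale bracket mult \<longleftrightarrow>
     bilinear_product scale mult \<and>
     (\<forall>x y. mult x y = mult y x) \<and>
     (\<forall>x y z. mult (bracket x y) z = mult x (mult y z) - mult y (mult x z)) \<and>
     (\<forall>x y z. mult x (bracket y z) = bracket (mult x y) z + bracket y (mult x z))"

text \<open>The span of all products of elements of two subsets; it is used both for the product
  of a CPA-structure and for the Lie bracket.\<close>

definition product_span ::
    "('k::field \<Rightarrow> 'v::ab_group_add \<Rightarrow> 'v) \<Rightarrow> ('v \<Rightarrow> 'v \<Rightarrow> 'v) \<Rightarrow> 'v set \<Rightarrow> 'v set \<Rightarrow> 'v set" where
  "product_span scale f A B = module.span scale {f a b |a b. a \<in> A \<and> b \<in> B}"

abbreviation derived_algebra ::
    "('k::field \<Rightarrow> 'v::ab_group_add \<Rightarrow> 'v) \<Rightarrow> ('v \<Rightarrow> 'v \<Rightarrow> 'v) \<Rightarrow> 'v set" where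
  "derived_algebra scale bracket \<equiv> product_span scale bracket UNIV UNIV"

text \<open>The Lie algebra \<open>L\<^sub>n\<close> with its distinguished basis \<open>e 1, \<dots>, e n\<close>; the values of
  \<open>e\<close> outside \<open>{1..n}\<close> are irrelevant.\<close>

locale standard_filiform = lie_algebra scale bracket
  for scale :: "'k::field \<Rightarrow> 'v::ab_group_add \<Rightarrow> 'v"
    and bracket :: "'v \<Rightarrow> 'v \<Rightarrow> 'v" +
  fixes n :: nat and e :: "nat \<Rightarrow> 'v"
  assumes basis_inj: "inj_on e {1..n}"
    and basis_independent: "independent (e ` {1..n})"
    and basis_span: "span (e ` {1..n}) = UNIV"
    and bracket_e1: "\<And>i. 2 \<le> i \<Longrightarrow> i \<le> n - 1 \<Longrightarrow> bracket (e 1) (e i) = e (i + 1)"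
    and bracket_e1_last: "bracket (e 1) (e n) = 0"
    and bracket_other: "\<And>i j. 2 \<le> i \<Longrightarrow> i \<le> n \<Longrightarrow> 2 \<le> j \<Longrightarrow> j \<le> n \<Longrightarrow> bracket (e i) (e j) = 0"

definition basis_coord ::
    "('k::field \<Rightarrow> 'v::ab_group_add \<Rightarrow> 'v) \<Rightarrow> nat \<Rightarrow> (nat \<Rightarrow> 'v) \<Rightarrow> 'v \<Rightarrow> nat \<Rightarrow> 'k" where
  "basis_coord scale n e x i = module.representation scale (e ` {1..n}) x (e i)"

text \<open>The commutative bilinear product with \<open>e i \<cdot> e j = T i j\<close> for \<open>i \<le> j\<close>; entries \<open>T i j\<close>
  with \<open>i > j\<close> are not used.\<close>

definition commutative_product ::
    "('k::field \<Rightarrow> 'v::ab_group_add \<Rightarrow> 'v) \<Rightarrow> nat \<Rightarrow> (nat \<Rightarrow> 'v) \<Rightarrow> (nat \<Rightarrow> nat \<Rightarrow> 'v) \<Rightarrow>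
     'v \<Rightarrow> 'v \<Rightarrow> 'v" where
  "commutative_product scale n e T x y =
     (\<Sum>i\<in>{1..n}. \<Sum>j\<in>{1..n}.
        scale (basis_coord scale n e x i * basis_coord scale n e y j) (T (min i j) (max i j)))"

text \<open>Of the sequence \<open>\<alpha>\<close> only the entries \<open>\<alpha> 2, \<dots>, \<alpha> n\<close> matter.\<close>

definition type1_product ::
    "('k::field \<Rightarrow> 'v::ab_group_add \<Rightarrow> 'v) \<Rightarrow> nat \<Rightarrow> (nat \<Rightarrow> 'v) \<Rightarrow>
     (nat \<Rightarrow> 'k) \<Rightarrow> 'k \<Rightarrow> 'k \<Rightarrow> 'k \<Rightarrow> 'v \<Rightarrow> 'v \<Rightarrow> 'v" where
  "type1_product scale n e \<alpha> \<beta> \<gamma> \<delta> = commutative_product scale n e (\<lambda>i j.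
     if i = 1 \<and> j = 1 then (\<Sum>k=2..n. scale (\<alpha> k) (e k))
     else if i = 1 \<and> j = 2 then scale \<beta> (e (n - 1)) + scale \<gamma> (e n)
     else if i = 1 \<and> j = 3 then scale \<beta> (e n)
     else if i = 2 \<and> j = 2 then scale \<delta> (e n)
     else 0)"

definition type2_product ::
    "('k::field \<Rightarrow> 'v::ab_group_add \<Rightarrow> 'v) \<Rightarrow> nat \<Rightarrow> (nat \<Rightarrow> 'v) \<Rightarrow>
     (nat \<Rightarrow> 'k) \<Rightarrow> 'k \<Rightarrow> 'k \<Rightarrow> 'k \<Rightarrow> 'v \<Rightarrow> 'v \<Rightarrow> 'v" where
  "type2_product scale n e \<alpha> \<beta> \<gamma> \<delta> = commutative_product scale n e (\<lambda>i j.
     if i = 1 \<and> j = 1 then (\<Sum>k=2..n. scale (\<alpha> k) (e k))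
     else if i = 1 \<and> j = 2 then e 3 + scale \<beta> (e (n - 1)) + scale \<gamma> (e n)
     else if i = 1 \<and> j = 3 then e 4 + scale \<beta> (e n)
     else if i = 1 \<and> 4 \<le> j \<and> j \<le> n - 1 then e (j + 1)
     else if i = 2 \<and> j = 2 then scale \<delta> (e n)
     else 0)"

end

theory Submission
  imports Defs
begin

text \<open>Write \<open>D\<close> for \<open>ad e\<^sub>1\<close>, \<open>M\<close> for left multiplication by \<open>e\<^sub>1\<close>, \<open>a = e\<^sub>1 \<cdot> e\<^sub>1\<close> and \<open>W\<close> for the
  abelian ideal spanned by \<open>e\<^sub>2, \<dots>, e\<^sub>n\<close>. Left multiplications are derivations, so they preserve \<open>W\<close>,
  and on \<open>W\<close> one gets \<open>u \<cdot> D w = D (u \<cdot> w)\<close> and \<open>M D = D M + a\<^sub>1 D\<close>.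

  To see that \<open>a\<^sub>1 = 0\<close>, apply each of the two identities \<open>D (w \<cdot> u) = M (w \<cdot> u) - w \<cdot> M u\<close> and
  \<open>M D w = M\<^sup>2 w - w \<cdot> a\<close> to \<open>D w\<close> and compare with its image under \<open>D\<close>: this yields \<open>a\<^sub>1 D (w \<cdot> u) = 0\<close>
  and \<open>2 a\<^sub>1 D M w = a\<^sub>1 D\<^sup>2 w\<close>, and if \<open>a\<^sub>1 \<noteq> 0\<close> the second identity contradicts the
  independence of \<open>e\<^sub>4\<close> and \<open>e\<^sub>5\<close>. Now \<open>M\<close> commutes with \<open>D\<close> on the cyclic module \<open>W\<close>, hence is a polynomial
  \<open>q(D)\<close>; the first identity gives \<open>D (w \<cdot> u) = 0\<close>, so \<open>W \<cdot> W\<close> is spanned by \<open>e\<^sub>2 \<cdot> e\<^sub>2 = \<delta> e\<^sub>n\<close>, and the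
  second becomes \<open>q\<^sup>2 - X q = a\<^sub>2 \<delta> X\<^bsup>n - 2\<^esup>\<close> modulo \<open>X\<^bsup>n - 1\<^esup>\<close>. Its solutions are
  \<open>q = s X + \<beta> X\<^bsup>n - 3\<^esup> + \<gamma> X\<^bsup>n - 2\<^esup>\<close> with \<open>s \<in> {0, 1}\<close> and \<open>(2 s - 1) \<beta> = a\<^sub>2 \<delta>\<close>, the two types.\<close>

section \<open>Bilinear products\<close>

context vector_space
begin

lemma bilinear_product_iff:
  "bilinear_product scale f \<longleftrightarrow>
     (\<forall>x y z. f (x + y) z = f x z + f y z) \<and> (\<forall>c x z. f (scale c x) z = scale c (f x z)) \<and>
     (\<forall>x y z. f z (x + y) = f z x + f z y) \<and> (\<forall>c x z. f z (scale c x) = scale c (f z x))"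
  unfolding bilinear_product_def Vector_Spaces.linear_iff by (auto simp: vector_space_axioms)

context
  fixes f
  assumes f: "bilinear_product scale f"
begin

lemma bilinear_add_left: "f (x + y) z = f x z + f y z"
  and bilinear_scale_left: "f (scale c x) z = scale c (f x z)"
  and bilinear_add_right: "f z (x + y) = f z x + f z y"
  and bilinear_scale_right: "f z (scale c x) = scale c (f z x)"
  using f unfolding bilinear_product_iff by blast+

lemma bilinear_zero_left: "f 0 z = 0"
  using bilinear_add_left[of 0 0 z] by simp

lemma bilinear_zero_right: "f z 0 = 0"
  using bilinear_add_right[of z 0 0] by simp

lemma bilinear_diff_left: "f (x - y) z = f x z - f y z"
  using bilinear_add_left[of "x - y" y z] by (simp add: algebra_simps)

lemma bilinear_diff_right: "f z (x - y) = f z x - f z y"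
  using bilinear_add_right[of z "x - y" y] by (simp add: algebra_simps)

lemma bilinear_sum_left: "f (\<Sum>i\<in>I. g i) z = (\<Sum>i\<in>I. f (g i) z)"
  by (induction I rule: infinite_finite_induct) (simp_all add: bilinear_zero_left bilinear_add_left)

lemma bilinear_sum_right: "f z (\<Sum>i\<in>I. g i) = (\<Sum>i\<in>I. f z (g i))"
  by (induction I rule: infinite_finite_induct) (simp_all add: bilinear_zero_right bilinear_add_right)

lemmas bilinear_simps = bilinear_add_left bilinear_add_right bilinear_scale_left
  bilinear_scale_right bilinear_zero_left bilinear_zero_right bilinear_diff_left bilinear_diff_right
  bilinear_sum_left bilinear_sum_right

end

end

section \<open>A quadratic equation for truncated power series\<close>

lemma convolution_two_terms:
  fixes q :: "nat \<Rightarrow> 'a::comm_ring_1"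
  assumes "2 \<le> m" "q 0 = 0" "\<And>k. 2 \<le> k \<Longrightarrow> k < m \<Longrightarrow> q k = 0"
  shows "(\<Sum>k\<le>m + 1. q k * q (m + 1 - k)) = 2 * q 1 * q m"
proof -
  have "q k * q (m + 1 - k) = 0" if "k \<le> m + 1" "k \<noteq> 1" "k \<noteq> m" for k
  proof -
    \<comment> \<open>The indices \<open>0\<close> and \<open>m + 1\<close> both bring in the factor
      \<open>q 0\<close>, so only \<open>1\<close> and \<open>m\<close> survive; they are distinct
      because \<open>2 \<le> m\<close>.\<close>
    have "k = 0 \<or> k = m + 1 \<or> 2 \<le> k \<and> k < m"
      using that by arith
    then show ?thesis
      using assms(2,3) by auto
  qed
  then have "(\<Sum>k\<le>m + 1. q k * q (m + 1 - k)) = (\<Sum>k\<in>{1, m}. q k * q (m + 1 - k))"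
    by (intro sum.mono_neutral_right) (use assms(1) in auto)
  then show ?thesis
    using assms(1) by (simp add: mult.commute)
qed

text \<open>In terms of the truncated power series \<open>q\<close>, the hypothesis reads
  \<open>q\<^sup>2 = X q + C X\<^sup>N\<close> modulo \<open>X\<^bsup>N + 1\<^esup>\<close>.\<close>

lemma convolution_square_solution:
  fixes q :: "nat \<Rightarrow> 'a::field"
  assumes "3 \<le> N"
    and eq: "\<And>j. j \<le> N \<Longrightarrow> (\<Sum>k\<le>j. q k * q (j - k)) =
        (if 1 \<le> j then q (j - 1) else 0) + (if j = N then C else 0)"
  shows "q 0 = 0" "q 1 = 0 \<or> q 1 = 1" "\<And>m. 2 \<le> m \<Longrightarrow> m \<le> N - 2 \<Longrightarrow> q m = 0"
    "(2 * q 1 - 1) * q (N - 1) = C"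
proof -
  show q0: "q 0 = 0"
    using eq[of 0] assms(1) by auto
  \<comment> \<open>Degree 2 lies below \<open>N\<close>, so the term with \<open>C\<close> is
    absent.\<close>
  have "q 1 * q 1 = q 1"
    using eq[of 2] assms(1) q0 by (auto simp: numeral_2_eq_2)
  then show q1: "q 1 = 0 \<or> q 1 = 1"
    by simp
  then have "2 * q 1 - 1 = 1 \<or> 2 * q 1 - 1 = - 1"
    by (elim disjE) simp_all
  \<comment> \<open>This factor will multiply \<open>q m\<close> in degree \<open>m + 1\<close>; it
    is invertible in every characteristic.\<close>
  then have unit: "2 * q 1 - 1 \<noteq> 0"
    by (metis neg_equal_0_iff_equal zero_neq_one)
  show zero: "q m = 0" if "2 \<le> m" "m \<le> N - 2" for m
    using that
  proof (induction m rule: less_induct)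
    case (less m)
    have "(\<Sum>k\<le>m + 1. q k * q (m + 1 - k)) = 2 * q 1 * q m"
      by (rule convolution_two_terms) (use less q0 in auto)
    moreover have "(\<Sum>k\<le>m + 1. q k * q (m + 1 - k)) = q m"
    proof -
      have "m + 1 \<le> N" "m + 1 \<noteq> N"
        using less.prems assms(1) by linarith+
      then show ?thesis
        using eq[of "m + 1"] by simp
    qed
    ultimately have "(2 * q 1 - 1) * q m = 0"
      by (simp add: algebra_simps)
    with unit show ?case
      by simp
  qed
  \<comment> \<open>Degree \<open>N\<close> itself, with \<open>m = N - 1\<close>: the same
    computation, now with \<open>C\<close> on the right.\<close>
  obtain m where m: "N = m + 1" "2 \<le> m"
    using assms(1) by (intro that[of "N - 1"]) auto
  have "(\<Sum>k\<le>m + 1. q k * q (m + 1 - k)) = 2 * q 1 * q m"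
    by (rule convolution_two_terms) (use m q0 zero in auto)
  moreover have "(\<Sum>k\<le>m + 1. q k * q (m + 1 - k)) = q m + C"
    using eq[of "m + 1"] m by simp
  ultimately show "(2 * q 1 - 1) * q (N - 1) = C"
    using m by (simp add: algebra_simps)
qed

section \<open>The standard filiform algebra in coordinates\<close>

text \<open>Characteristic 0 enters where \<open>3 * c = 0\<close> forces \<open>c = 0\<close>; the
  theorem is the case of the complex numbers.\<close>

locale long_filiform = standard_filiform scale bracket n e
  for scale :: "'k::field_char_0 \<Rightarrow> 'v::ab_group_add \<Rightarrow> 'v" (infixr "*s" 75)
    and bracket :: "'v \<Rightarrow> 'v \<Rightarrow> 'v" and n :: nat and e :: "nat \<Rightarrow> 'v" +
  assumes n_ge_5: "5 \<le> n"
begin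

declare One_nat_def [simp del] add_2_eq_Suc [simp del] add_2_eq_Suc' [simp del]

abbreviation coord :: "'v \<Rightarrow> nat \<Rightarrow> 'k" where
  "coord \<equiv> basis_coord scale n e"

lemma coord_add [simp]: "coord (x + y) i = coord x i + coord y i"
  by (simp add: basis_coord_def representation_add basis_independent basis_span)

lemma coord_scale [simp]: "coord (c *s x) i = c * coord x i"
  by (simp add: basis_coord_def representation_scale basis_independent basis_span)

lemma coord_zero [simp]: "coord 0 i = 0"
  by (simp add: basis_coord_def representation_zero)

lemma coord_uminus [simp]: "coord (- x) i = - coord x i"
  using coord_add[of x "- x" i] by (simp add: add_eq_0_iff)

lemma coord_diff [simp]: "coord (x - y) i = coord x i - coord y i"
  using coord_add[of x "- y" i] by simp

lemma coord_sum [simp]: "coord (\<Sum>j\<in>I. g j) i = (\<Sum>j\<in>I. coord (g j) i)"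
  by (induction I rule: infinite_finite_induct) simp_all

lemma coord_basis [simp]:
  assumes "1 \<le> i" "i \<le> n" "1 \<le> j" "j \<le> n"
  shows "coord (e i) j = (if i = j then 1 else 0)"
proof -
  have "e j = e i \<longleftrightarrow> i = j"
    using inj_on_eq_iff[OF basis_inj, of j i] assms by auto
  then show ?thesis
    using assms by (simp add: basis_coord_def representation_basis[OF basis_independent])
qed

lemma basis_expansion: "(\<Sum>i=1..n. coord x i *s e i) = x"
proof -
  have "x = (\<Sum>b\<in>e ` {1..n}. representation (e ` {1..n}) x b *s b)"
    by (rule sum_representation_eq[symmetric]) (simp_all add: basis_independent basis_span)
  also have "\<dots> = (\<Sum>i=1..n. coord x i *s e i)"
    by (subst sum.reindex[OF basis_inj]) (simp add: basis_coord_def)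
  finally show ?thesis ..
qed

lemma coord_eqI:
  assumes "\<And>i. 1 \<le> i \<Longrightarrow> i \<le> n \<Longrightarrow> coord x i = coord y i"
  shows "x = y"
proof -
  have "(\<Sum>i=1..n. coord x i *s e i) = (\<Sum>i=1..n. coord y i *s e i)"
    by (rule sum.cong) (use assms in auto)
  then show ?thesis
    unfolding basis_expansion .
qed

lemma bilinear_expansion:
  assumes "bilinear_product scale f"
  shows "f x y = (\<Sum>i=1..n. \<Sum>j=1..n. (coord x i * coord y j) *s f (e i) (e j))"
proof -
  have "f x y = f (\<Sum>i=1..n. coord x i *s e i) (\<Sum>j=1..n. coord y j *s e j)"
    by (simp add: basis_expansion)
  then show ?thesis
    by (subst sum.swap) (simp add: bilinear_simps[OF assms] scale_sum_right mult.commute)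
qed

lemma bilinear_eqI:
  assumes "bilinear_product scale f" "bilinear_product scale g"
    and "\<And>i j. 1 \<le> i \<Longrightarrow> i \<le> n \<Longrightarrow> 1 \<le> j \<Longrightarrow> j \<le> n \<Longrightarrow> f (e i) (e j) = g (e i) (e j)"
  shows "f = g"
proof (intro ext)
  fix x y
  show "f x y = g x y"
    unfolding bilinear_expansion[OF assms(1), of x y] bilinear_expansion[OF assms(2), of x y]
    by (intro sum.cong refl) (use assms(3) in auto)
qed

lemma bilinear_commutative_eqI:
  assumes "bilinear_product scale f" "bilinear_product scale g"
    and "\<And>x y. f x y = f y x" "\<And>x y. g x y = g y x"
    and "\<And>i j. 1 \<le> i \<Longrightarrow> i \<le> j \<Longrightarrow> j \<le> n \<Longrightarrow> f (e i) (e j) = g (e i) (e j)"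
  shows "f = g"
proof (rule bilinear_eqI[OF assms(1,2)])
  fix i j assume "1 \<le> i" "i \<le> n" "1 \<le> j" "j \<le> n"
  then show "f (e i) (e j) = g (e i) (e j)"
    using assms(5)[of i j] assms(5)[of j i] assms(3)[of "e i" "e j"] assms(4)[of "e i" "e j"]
    by (cases "i \<le> j") auto
qed

lemmas bracket_simps = bilinear_simps[OF bracket_bilinear]

lemma bracket_skew: "bracket y x = - bracket x y"
proof -
  have "bracket y x + bracket x y = bracket (x + y) (x + y)"
    by (simp add: bracket_simps bracket_alternating[of x] bracket_alternating[of y])
  then show ?thesis
    by (simp add: bracket_alternating eq_neg_iff_add_eq_0)
qed

definition D :: "'v \<Rightarrow> 'v" where
  "D = bracket (e 1)"

lemma D_simps [simp]:
  "D (x + y) = D x + D y" "D (x - y) = D x - D y" "D (c *s x) = c *s D x" "D 0 = 0"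
  "D (\<Sum>i\<in>I. g i) = (\<Sum>i\<in>I. D (g i))"
  unfolding D_def by (simp_all add: bracket_simps)

lemma D_basis:
  assumes "1 \<le> i" "i \<le> n"
  shows "D (e i) = (if 2 \<le> i \<and> i < n then e (i + 1) else 0)"
proof -
  consider "i = 1" | "2 \<le> i" "i \<le> n - 1" | "i = n"
    using assms by linarith
  then show ?thesis
    using assms n_ge_5 by cases (auto simp: D_def bracket_e1 bracket_e1_last bracket_alternating)
qed

text \<open>\<open>D\<close> kills \<open>e 1\<close>, so coordinates are shifted only from index 2
  on; hence the bound 3.\<close>

lemma coord_D:
  assumes "1 \<le> j" "j \<le> n"
  shows "coord (D x) j = (if 3 \<le> j then coord x (j - 1) else 0)"
proof -
  have "coord (D x) j = coord (D (\<Sum>i=1..n. coord x i *s e i)) j"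
    by (simp add: basis_expansion)
  also have "\<dots> = (\<Sum>i=1..n. if i = j - 1 \<and> 3 \<le> j then coord x i else 0)"
    unfolding D_simps coord_sum by (intro sum.cong refl) (use assms in \<open>auto simp: D_basis\<close>)
  also have "\<dots> = (if 3 \<le> j then coord x (j - 1) else 0)"
    using assms by (cases "3 \<le> j") (auto simp: sum.delta)
  finally show ?thesis .
qed

lemma coord_D_1 [simp]: "coord (D x) 1 = 0"
  and coord_D_2 [simp]: "coord (D x) 2 = 0"
  and coord_D_3 [simp]: "coord (D x) 3 = coord x 2"
  using coord_D[of 1 x] coord_D[of 2 x] coord_D[of 3 x] n_ge_5 by simp_all

text \<open>Elements with first coordinate 0 commute, so every bracket can be expressed through
  \<open>D\<close> alone.\<close>

lemma bracket_eq: "bracket x y = coord x 1 *s D y - coord y 1 *s D x"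
proof -
  have "bracket = (\<lambda>x y. coord x 1 *s D y - coord y 1 *s D x)"
  proof (rule bilinear_eqI[OF bracket_bilinear])
    show "bilinear_product scale (\<lambda>x y. coord x 1 *s D y - coord y 1 *s D x)"
      unfolding bilinear_product_iff
      by (simp add: scale_left_distrib scale_right_distrib scale_right_diff_distrib mult.commute)
  next
    fix i j assume ij: "1 \<le> i" "i \<le> n" "1 \<le> j" "j \<le> n"
    consider "i = 1" | "j = 1" | "2 \<le> i" "2 \<le> j"
      using ij by linarith
    then show "bracket (e i) (e j) = coord (e i) 1 *s D (e j) - coord (e j) 1 *s D (e i)"
    proof cases
      case 1
      then show ?thesis
        using ij by (auto simp: D_def bracket_alternating)
    next
      case 2
      then show ?thesis
        using ij bracket_skew[of "e 1" "e i"] by (auto simp: D_def bracket_alternating)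
    next
      case 3
      then show ?thesis
        using ij bracket_other by auto
    qed
  qed
  then show ?thesis
    by (simp add: fun_eq_iff)
qed

text \<open>For \<open>2 \<le> i\<close> and \<open>i < n\<close>, coordinate \<open>i\<close> of
  \<open>x\<close> reappears as coordinate \<open>i + 1\<close> of \<open>D x\<close>, so on
  \<open>W\<close> only the last one is lost.\<close>

lemma D_eq_0_imp:
  assumes "D x = 0" "coord x 1 = 0"
  shows "x = coord x n *s e n"
proof (rule coord_eqI)
  fix i assume "1 \<le> i" "i \<le> n"
  have "coord x i = 0" if "2 \<le> i" "i < n"
    using coord_D[of "i + 1" x] assms that by simp
  with \<open>1 \<le> i\<close> \<open>i \<le> n\<close> assms n_ge_5 show "coord x i = coord (coord x n *s e n) i"
    by (cases "i = 1") auto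
qed

section \<open>Products prescribed on basis vectors\<close>

lemma commutative_product_bilinear: "bilinear_product scale (commutative_product scale n e T)"
  unfolding bilinear_product_iff commutative_product_def
  by (auto simp: distrib_left distrib_right scale_left_distrib sum.distrib scale_sum_right mult.assoc
      mult.left_commute)

lemma commutative_product_commute:
  "commutative_product scale n e T x y = commutative_product scale n e T y x"
  unfolding commutative_product_def
  by (subst sum.swap) (simp add: min.commute max.commute mult.commute)

lemma commutative_product_basis:
  assumes "1 \<le> i" "i \<le> j" "j \<le> n"
  shows "commutative_product scale n e T (e i) (e j) = T i j"
proof -
  have "commutative_product scale n e T (e i) (e j) =
      (\<Sum>k=1..n. \<Sum>l=1..n. if k = i then if l = j then T (min k l) (max k l) else 0 else 0)"
    unfolding commutative_product_def using assms by (intro sum.cong refl) auto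
  also have "\<dots> = (\<Sum>k=1..n. if k = i then (\<Sum>l=1..n. if l = j then T (min k l) (max k l) else 0) else 0)"
    by (intro sum.cong refl) auto
  also have "\<dots> = T i j"
    using assms by (simp add: sum.delta)
  finally show ?thesis .
qed

section \<open>The two families of products\<close>

text \<open>\<open>Q s \<beta> \<gamma> = s D + \<beta> D\<^bsup>n - 3\<^esup> + \<gamma> D\<^bsup>n - 2\<^esup>\<close>; type 1 of the classification is \<open>s = 0\<close>,
  type 2 is \<open>s = 1\<close>.\<close>

definition Q :: "'k \<Rightarrow> 'k \<Rightarrow> 'k \<Rightarrow> 'v \<Rightarrow> 'v" where
  "Q s \<beta> \<gamma> x = s *s D x + \<beta> *s (coord x 2 *s e (n - 1) + coord x 3 *s e n) + (\<gamma> * coord x 2) *s e n"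

text \<open>One coordinate formula for both types. As \<open>Q s \<beta> \<gamma>\<close> kills
  \<open>e 1\<close>, the square of \<open>e 1\<close> is exactly \<open>a\<close>; on
  \<open>W\<close> only the term with \<open>\<delta>\<close> remains.\<close>

definition filiform_product :: "'k \<Rightarrow> 'v \<Rightarrow> 'k \<Rightarrow> 'k \<Rightarrow> 'k \<Rightarrow> 'v \<Rightarrow> 'v \<Rightarrow> 'v" where
  "filiform_product s a \<beta> \<gamma> \<delta> x y =
     (coord x 1 * coord y 1) *s a + coord x 1 *s Q s \<beta> \<gamma> y + coord y 1 *s Q s \<beta> \<gamma> x
       + (\<delta> * (coord x 2 * coord y 2)) *s e n"

lemma Q_simps [simp]:
  "Q s \<beta> \<gamma> (x + y) = Q s \<beta> \<gamma> x + Q s \<beta> \<gamma> y"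
  "Q s \<beta> \<gamma> (x - y) = Q s \<beta> \<gamma> x - Q s \<beta> \<gamma> y"
  "Q s \<beta> \<gamma> (c *s x) = c *s Q s \<beta> \<gamma> x"
  unfolding Q_def by (simp_all add: algebra_simps)

lemma coord_Q [simp]:
  "coord (Q s \<beta> \<gamma> x) 1 = 0" "coord (Q s \<beta> \<gamma> x) 2 = 0"
  "coord (Q s \<beta> \<gamma> x) 3 = s * coord x 2"
  unfolding Q_def using n_ge_5 by auto

lemma coord_en [simp]: "coord (e n) 1 = 0" "coord (e n) 2 = 0" "coord (e n) 3 = 0"
  using n_ge_5 by simp_all

lemma D_en [simp]: "D (e n) = 0" and D_en1: "D (e (n - 1)) = e n"
  using n_ge_5 by (auto simp: D_basis)

lemma Q_en [simp]: "Q s \<beta> \<gamma> (e n) = 0"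
  unfolding Q_def by simp

lemma Q_basis:
  assumes "1 \<le> i" "i \<le> n"
  shows "Q s \<beta> \<gamma> (e i) = (if i = 2 then s *s e 3 + \<beta> *s e (n - 1) + \<gamma> *s e n
     else if i = 3 then s *s e 4 + \<beta> *s e n
     else if 4 \<le> i \<and> i \<le> n - 1 then s *s e (i + 1) else 0)"
  using assms n_ge_5 unfolding Q_def by (auto simp: D_basis)

lemma Q_D: "Q s \<beta> \<gamma> (D x) = D (Q s \<beta> \<gamma> x)"
  unfolding Q_def by (simp add: D_en1)

text \<open>Beyond \<open>s *s D\<close>, the outer map sees only coordinates 2 and 3 of
  \<open>Q s \<beta> \<gamma> x\<close>, which are 0 and \<open>s * coord x 2\<close>.\<close>

lemma Q_Q: "Q s \<beta> \<gamma> (Q s \<beta> \<gamma> x) = s *s D (Q s \<beta> \<gamma> x) + (\<beta> * s * coord x 2) *s e n"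
  unfolding Q_def[of s \<beta> \<gamma> "Q s \<beta> \<gamma> x"] by simp

lemma D_Q: "D (Q s \<beta> \<gamma> x) = s *s D (D x) + (\<beta> * coord x 2) *s e n"
  unfolding Q_def by (simp add: D_en1)

lemma filiform_product_bilinear: "bilinear_product scale (filiform_product s a \<beta> \<gamma> \<delta>)"
  unfolding bilinear_product_iff filiform_product_def by (simp add: algebra_simps)

lemma filiform_product_commute:
  "filiform_product s a \<beta> \<gamma> \<delta> x y = filiform_product s a \<beta> \<gamma> \<delta> y x"
  unfolding filiform_product_def by (simp add: algebra_simps)

lemma type1_product_eq:
  "type1_product scale n e \<alpha> \<beta> \<gamma> \<delta> = filiform_product 0 (\<Sum>k=2..n. \<alpha> k *s e k) \<beta> \<gamma> \<delta>"
  unfolding type1_product_def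
  by (rule bilinear_commutative_eqI[OF commutative_product_bilinear filiform_product_bilinear
        commutative_product_commute filiform_product_commute], subst commutative_product_basis)
    (use n_ge_5 in \<open>auto simp: filiform_product_def Q_basis\<close>)

lemma type2_product_eq:
  "type2_product scale n e \<alpha> \<beta> \<gamma> \<delta> = filiform_product 1 (\<Sum>k=2..n. \<alpha> k *s e k) \<beta> \<gamma> \<delta>"
  unfolding type2_product_def
  by (rule bilinear_commutative_eqI[OF commutative_product_bilinear filiform_product_bilinear
        commutative_product_commute filiform_product_commute], subst commutative_product_basis)
    (use n_ge_5 in \<open>auto simp: filiform_product_def Q_basis\<close>)

text \<open>The condition on \<open>\<beta>\<close> yields the identity \<open>QQ\<close>, on which
  the axiom for \<open>[x, y] \<cdot> z\<close> rests; the derivation axiom rests on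
  \<open>Q s \<beta> \<gamma>\<close> commuting with \<open>D\<close>.\<close>

lemma filiform_product_cpa:
  assumes "s = 0 \<or> s = 1" "coord a 1 = 0" "\<beta> = (2 * s - 1) * (coord a 2 * \<delta>)"
  shows "cpa_structure scale bracket (filiform_product s a \<beta> \<gamma> \<delta>)"
proof -
  let ?f = "filiform_product s a \<beta> \<gamma> \<delta>" and ?Q = "Q s \<beta> \<gamma>"
  have QQ: "?Q (?Q x) = D (?Q x) + (\<delta> * coord a 2 * coord x 2) *s e n" for x
    using assms(1)
  proof
    \<comment> \<open>Here \<open>?Q\<close> squares to zero, and \<open>D (?Q x)\<close> is a
      multiple of \<open>e n\<close> that cancels the last summand.\<close>
    assume "s = 0"
    then have "\<beta> = - (coord a 2 * \<delta>)"
      using assms(3) by simp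
    then show ?thesis
      using \<open>s = 0\<close> by (simp add: Q_Q D_Q mult_ac)
  next
    assume "s = 1"
    then show ?thesis
      using assms(3) by (simp add: Q_Q mult_ac)
  qed
  have "?f (bracket x y) z = ?f x (?f y z) - ?f y (?f x z)" for x y z
    using assms(2) by (simp add: filiform_product_def bracket_eq QQ Q_D algebra_simps)
  moreover have "?f x (bracket y z) = bracket (?f x y) z + bracket y (?f x z)" for x y z
    using assms(2) by (simp add: filiform_product_def bracket_eq Q_D algebra_simps)
  ultimately show ?thesis
    using filiform_product_bilinear filiform_product_commute unfolding cpa_structure_def by blast
qed

section \<open>Products with the derived algebra\<close>

lemma coord_derived:
  assumes "x \<in> derived_algebra scale bracket"
  shows "coord x 1 = 0 \<and> coord x 2 = 0"
  using assms unfolding product_span_def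
  by (induction rule: span_induct_alt) (auto simp: bracket_eq)

text \<open>Each summand of the product has a factor \<open>coord _ 1\<close> or
  \<open>coord _ 2\<close>, and these vanish on the derived algebra.\<close>

lemma filiform_product_derived:
  "product_span scale (filiform_product s a \<beta> \<gamma> \<delta>)
     (derived_algebra scale bracket) (derived_algebra scale bracket) = {0}"
proof -
  have "{filiform_product s a \<beta> \<gamma> \<delta> x y |x y.
      x \<in> derived_algebra scale bracket \<and> y \<in> derived_algebra scale bracket} \<subseteq> {0}"
    using coord_derived by (auto simp: filiform_product_def)
  then have "span {filiform_product s a \<beta> \<gamma> \<delta> x y |x y.
      x \<in> derived_algebra scale bracket \<and> y \<in> derived_algebra scale bracket} \<subseteq> {0}"
    by (rule span_minimal) (rule subspace_single_0)
  then show ?thesis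
    unfolding product_span_def[of scale "filiform_product s a \<beta> \<gamma> \<delta>"] using span_zero by blast
qed

lemma product_span_derived_ne_0:
  assumes "f (e 1) (e 3) \<noteq> 0"
  shows "product_span scale f UNIV (derived_algebra scale bracket) \<noteq> {0}"
proof -
  have "bracket (e 1) (e 2) = e 3"
    using n_ge_5 by (simp add: bracket_e1)
  then have "e 3 \<in> derived_algebra scale bracket"
    unfolding product_span_def by (intro span_base) (auto intro: sym)
  then have "f (e 1) (e 3) \<in> product_span scale f UNIV (derived_algebra scale bracket)"
    unfolding product_span_def[of _ f] by (intro span_base) auto
  with assms show ?thesis
    by auto
qed

section \<open>Arbitrary CPA-structures\<close>

lemma D_pow_simps:
  "(D ^^ k) (x + y) = (D ^^ k) x + (D ^^ k) y" "(D ^^ k) (c *s x) = c *s (D ^^ k) x"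
  "(D ^^ k) (\<Sum>i\<in>I. g i) = (\<Sum>i\<in>I. (D ^^ k) (g i))"
  by (induction k) simp_all

text \<open>The hypothesis on \<open>coord x 1\<close> settles the case \<open>k = 0\<close>,
  \<open>j = 1\<close>, where the right-hand side is 0.\<close>

lemma coord_D_pow:
  assumes "coord x 1 = 0" "1 \<le> j" "j \<le> n"
  shows "coord ((D ^^ k) x) j = (if k + 2 \<le> j then coord x (j - k) else 0)"
  using assms(2,3)
proof (induction k arbitrary: j)
  case 0
  then show ?case
    using assms(1) by (cases "j = 1") auto
next
  case (Suc k)
  have "coord ((D ^^ Suc k) x) j = (if 3 \<le> j then coord ((D ^^ k) x) (j - 1) else 0)"
    using Suc.prems by (simp add: coord_D)
  also have "\<dots> = (if Suc k + 2 \<le> j then coord x (j - Suc k) else 0)"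
    using Suc.prems Suc.IH[of "j - 1"] by (auto simp: plus_1_eq_Suc)
  finally show ?case .
qed

lemma D_pow_e2:
  assumes "k + 2 \<le> n"
  shows "(D ^^ k) (e 2) = e (k + 2)"
  using assms by (induction k) (auto simp: D_basis eval_nat_numeral One_nat_def)

text \<open>\<open>W\<close> is a cyclic module over the polynomials in \<open>D\<close>, with
  generator \<open>e 2\<close>; the exponent \<open>k\<close> belongs to coordinate
  \<open>k + 2\<close>.\<close>

lemma expansion_D_pow:
  assumes "coord x 1 = 0"
  shows "x = (\<Sum>k\<le>n - 2. coord x (k + 2) *s (D ^^ k) (e 2))"
proof -
  have "x = coord x 1 *s e 1 + (\<Sum>i=2..n. coord x i *s e i)"
    using basis_expansion[of x] n_ge_5 by (simp add: sum.atLeast_Suc_atMost numeral_2_eq_2 One_nat_def)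
  also have "\<dots> = (\<Sum>i=0+2..(n-2)+2. coord x i *s e i)"
    using assms n_ge_5 by (simp del: add_2_eq_Suc add_2_eq_Suc')
  also have "\<dots> = (\<Sum>k=0..n - 2. coord x (k + 2) *s e (k + 2))"
    by (rule sum.shift_bounds_cl_nat_ivl)
  also have "\<dots> = (\<Sum>k\<le>n - 2. coord x (k + 2) *s (D ^^ k) (e 2))"
    using n_ge_5 by (intro sum.cong) (auto simp: D_pow_e2)
  finally show ?thesis .
qed

context
  fixes mult :: "'v \<Rightarrow> 'v \<Rightarrow> 'v"  (infixl "\<cdot>" 70)
  assumes cpa: "cpa_structure scale bracket mult"
begin

section \<open>Left multiplications as derivations\<close>

lemma mult_bilinear: "bilinear_product scale mult"
  and mult_commute: "x \<cdot> y = y \<cdot> x"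
  and bracket_mult: "bracket x y \<cdot> z = x \<cdot> (y \<cdot> z) - y \<cdot> (x \<cdot> z)"
  and mult_bracket: "x \<cdot> bracket y z = bracket (x \<cdot> y) z + bracket y (x \<cdot> z)"
  using cpa unfolding cpa_structure_def by blast+

lemmas mult_simps = bilinear_simps[OF mult_bilinear]

text \<open>Apply the derivation \<open>x \<cdot> _\<close> to the zero bracket of \<open>w\<close>
  and \<open>e 3\<close>. As \<open>e 3\<close> is itself a bracket, \<open>x \<cdot> e 3\<close>
  lies in \<open>W\<close>, and what remains is
  \<open>coord (x \<cdot> w) 1 *s e 4 = 0\<close>.\<close>

lemma coord_mult_1:
  assumes "coord w 1 = 0"
  shows "coord (x \<cdot> w) 1 = 0"
proof -
  have "coord (x \<cdot> e 3) 1 = 0"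
    using mult_bracket[of x "e 1" "e 2"] n_ge_5 by (simp add: bracket_eq D_basis)
  moreover have "x \<cdot> bracket w (e 3) = 0"
    using assms n_ge_5 by (simp add: bracket_eq mult_simps)
  moreover have "bracket (x \<cdot> w) (e 3) + bracket w (x \<cdot> e 3) = x \<cdot> bracket w (e 3)"
    by (rule mult_bracket[symmetric])
  ultimately have "coord (x \<cdot> w) 1 *s e 4 = 0"
    using assms n_ge_5 by (simp add: bracket_eq[of _ "e 3"] bracket_eq[of w] D_basis)
  then have "coord (coord (x \<cdot> w) 1 *s e 4) 4 = 0"
    by (simp only: coord_zero)
  then show ?thesis
    unfolding coord_scale using n_ge_5 by simp
qed

text \<open>In the derivation rule at \<open>[e 1, w]\<close> the term
  \<open>[u \<cdot> e 1, w]\<close> vanishes: by commutativity \<open>u \<cdot> e 1\<close> lies in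
  the abelian ideal \<open>W\<close>.\<close>

lemma D_mult:
  assumes "coord w 1 = 0" "coord u 1 = 0"
  shows "u \<cdot> D w = D (u \<cdot> w)"
  using mult_bracket[of u "e 1" w] coord_mult_1[of u "e 1"] coord_mult_1[of w u] assms n_ge_5
  by (simp add: bracket_eq D_basis mult_commute)

lemma coord_D_pow_1:
  assumes "coord w 1 = 0"
  shows "coord ((D ^^ k) w) 1 = 0"
  using assms n_ge_5 by (simp add: coord_D_pow)

lemma mult_D_pow:
  assumes "coord w 1 = 0" "coord u 1 = 0"
  shows "u \<cdot> (D ^^ k) w = (D ^^ k) (u \<cdot> w)"
  using assms by (induction k) (simp_all add: D_mult coord_D_pow_1)

lemma e1_mult_D:
  assumes "coord w 1 = 0"
  shows "e 1 \<cdot> D w = coord (e 1 \<cdot> e 1) 1 *s D w + D (e 1 \<cdot> w)"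
  using mult_bracket[of "e 1" "e 1" w] assms n_ge_5 by (simp add: bracket_eq D_basis)

text \<open>The axiom for \<open>[e 1, w] \<cdot> u\<close>, with \<open>D\<close> moved outside by
  \<open>D_mult\<close>.\<close>

lemma D_mult_eq:
  assumes "coord w 1 = 0" "coord u 1 = 0"
  shows "D (w \<cdot> u) = e 1 \<cdot> (w \<cdot> u) - w \<cdot> (e 1 \<cdot> u)"
  using bracket_mult[of "e 1" w u] D_mult[of w u] assms n_ge_5
  by (simp add: bracket_eq mult_commute[of "D w" u] mult_commute[of u w])

section \<open>The square of \<open>e 1\<close> lies in \<open>W\<close>\<close>

lemma e1_square_D_mult:
  assumes "coord w 1 = 0" "coord u 1 = 0"
  shows "coord (e 1 \<cdot> e 1) 1 *s D (w \<cdot> u) = 0"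
proof -
  have mult_D: "D v \<cdot> y = D (v \<cdot> y)" if "coord v 1 = 0" "coord y 1 = 0" for v y
    using D_mult[OF that] by (simp add: mult_commute)
  \<comment> \<open>This is \<open>D_mult_eq\<close> at \<open>D w\<close>, with \<open>D\<close>
    pulled out of products within \<open>W\<close>. Subtracting the image of
    \<open>D_mult_eq\<close> under \<open>D\<close> leaves the failure of
    \<open>e 1 \<cdot> _\<close> to commute with \<open>D\<close>.\<close>
  have "D (D (w \<cdot> u)) = e 1 \<cdot> D (w \<cdot> u) - D (w \<cdot> (e 1 \<cdot> u))"
    using D_mult_eq[of "D w" u] assms by (simp add: mult_D coord_mult_1)
  then show ?thesis
    using arg_cong[OF D_mult_eq[OF assms], of D] assms
    by (simp add: e1_mult_D coord_mult_1)
qed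

text \<open>The component of \<open>e 1 \<cdot> e 1\<close> in \<open>W\<close>:
  \<open>D_mult\<close> applies to it before the remaining component is known to vanish.\<close>

definition square_tail :: 'v where
  "square_tail = e 1 \<cdot> e 1 - coord (e 1 \<cdot> e 1) 1 *s e 1"

lemma coord_square_tail [simp]: "coord square_tail 1 = 0" "coord square_tail 2 = coord (e 1 \<cdot> e 1) 2"
  unfolding square_tail_def using n_ge_5 by simp_all

text \<open>The axiom for \<open>[e 1, w] \<cdot> e 1\<close>, with \<open>e 1 \<cdot> e 1\<close>
  split into its component along \<open>e 1\<close> and its component in \<open>W\<close>.\<close>

lemma e1_e1_mult:
  assumes "coord w 1 = 0"
  shows "e 1 \<cdot> (e 1 \<cdot> w) = e 1 \<cdot> D w + coord (e 1 \<cdot> e 1) 1 *s (e 1 \<cdot> w) + w \<cdot> square_tail"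
proof -
  have "D w \<cdot> e 1 = e 1 \<cdot> (w \<cdot> e 1) - w \<cdot> (e 1 \<cdot> e 1)"
    using bracket_mult[of "e 1" w "e 1"] assms n_ge_5 by (simp add: bracket_eq)
  moreover have "w \<cdot> (e 1 \<cdot> e 1) = coord (e 1 \<cdot> e 1) 1 *s (w \<cdot> e 1) + w \<cdot> square_tail"
    unfolding square_tail_def by (simp add: mult_simps)
  ultimately show ?thesis
    by (simp add: mult_commute[of "D w" "e 1"] mult_commute[of w "e 1"])
qed

lemma e1_square_D_e1_mult:
  assumes "coord w 1 = 0"
  shows "coord (e 1 \<cdot> e 1) 1 *s (D (e 1 \<cdot> w) + D (e 1 \<cdot> w)) = coord (e 1 \<cdot> e 1) 1 *s D (D w)"
proof -
  have "D w \<cdot> square_tail = D (w \<cdot> square_tail)"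
    using D_mult[of w square_tail] assms by (simp add: mult_commute)
  \<comment> \<open>In the comparison the terms with \<open>square_tail\<close> cancel, and so do
    those quadratic in the coefficient.\<close>
  then show ?thesis
    using e1_e1_mult[of "D w"] arg_cong[OF e1_e1_mult[OF assms], of D] assms
    by (simp add: e1_mult_D coord_mult_1 mult_simps algebra_simps)
qed

lemma coord_e1_square_1: "coord (e 1 \<cdot> e 1) 1 = 0"
proof (rule ccontr)
  define c where "c = coord (e 1 \<cdot> e 1) 1"
  assume "coord (e 1 \<cdot> e 1) 1 \<noteq> 0"
  then have c: "c \<noteq> 0"
    by (simp add: c_def)
  have two_D: "D (e 1 \<cdot> w) + D (e 1 \<cdot> w) = D (D w)" if "coord w 1 = 0" for w
    using scale_left_imp_eq[OF c e1_square_D_e1_mult[OF that, folded c_def]] .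
  have two: "2 * coord (D (e 1 \<cdot> w)) 4 = coord (D (D w)) 4" if "coord w 1 = 0" for w
    using arg_cong[OF two_D[OF that], of "\<lambda>x. coord x 4"] by simp
  have e2: "coord (e 2) 1 = 0" "D (D (e 2)) = e 4" "D (D (D (e 2))) = e 5"
    using n_ge_5 by (simp_all add: D_basis)
  \<comment> \<open>One more \<open>D\<close> turns the right-hand side of \<open>two_D\<close> at
    \<open>e 2\<close> into \<open>e 5\<close>, whose coordinate 4 is zero.\<close>
  have "D (D (e 1 \<cdot> e 2)) + D (D (e 1 \<cdot> e 2)) = e 5"
    using arg_cong[OF two_D[OF e2(1)], of D] e2 by simp
  then have 1: "2 * coord (D (D (e 1 \<cdot> e 2))) 4 = coord (e 5) 4"
    using coord_add[of "D (D (e 1 \<cdot> e 2))" "D (D (e 1 \<cdot> e 2))" 4] by simp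
  have 2: "2 * coord (D (e 1 \<cdot> (e 1 \<cdot> e 2))) 4 = coord (D (D (e 1 \<cdot> e 2))) 4"
    using e2(1) by (intro two coord_mult_1)
  \<comment> \<open>This removes the \<open>square_tail\<close> term from the image of
    \<open>e1_e1_mult\<close> at \<open>e 2\<close> under \<open>D\<close>.\<close>
  have "D (e 2 \<cdot> square_tail) = 0"
    using e1_square_D_mult[of "e 2" square_tail] c e2(1) by (simp add: c_def)
  then have "D (e 1 \<cdot> (e 1 \<cdot> e 2)) = c *s e 4 + D (D (e 1 \<cdot> e 2)) + c *s D (e 1 \<cdot> e 2)"
    using arg_cong[OF e1_e1_mult[OF e2(1)], of D] e2 by (simp add: e1_mult_D c_def)
  from arg_cong[OF this, of "\<lambda>x. coord x 4"]
  have 3: "coord (D (e 1 \<cdot> (e 1 \<cdot> e 2))) 4 =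
      c * coord (e 4) 4 + coord (D (D (e 1 \<cdot> e 2))) 4 + c * coord (D (e 1 \<cdot> e 2)) 4"
    by simp
  have 4: "2 * coord (D (e 1 \<cdot> e 2)) 4 = coord (e 4) 4"
    using two[OF e2(1)] e2(2) by simp
  \<comment> \<open>Facts \<open>1\<close> and \<open>2\<close> kill the left-hand side and the
    middle term of \<open>3\<close>; by \<open>4\<close> its last term is \<open>c / 2\<close>, so
    \<open>c + c / 2 = 0\<close>.\<close>
  have "coord (e 5) 4 = 0" "coord (e 4) 4 = 1"
    using n_ge_5 by simp_all
  then have "3 * c = 0"
    using 1 2 3 4 by algebra
  with c show False
    by simp
qed

section \<open>Multiplication by \<open>e 1\<close> as a polynomial in \<open>D\<close>\<close>

lemma e1_mult_D_pow:
  assumes "coord w 1 = 0"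
  shows "e 1 \<cdot> (D ^^ k) w = (D ^^ k) (e 1 \<cdot> w)"
  using assms by (induction k) (simp_all add: e1_mult_D coord_e1_square_1 coord_D_pow_1)

text \<open>A linear map commuting with \<open>D\<close> on the cyclic module \<open>W\<close> is a
  polynomial in \<open>D\<close>, with coefficients read off from its value at
  \<open>e 2\<close>.\<close>

lemma e1_mult_expansion:
  assumes "coord w 1 = 0"
  shows "e 1 \<cdot> w = (\<Sum>k\<le>n - 2. coord (e 1 \<cdot> e 2) (k + 2) *s (D ^^ k) w)"
proof -
  have e2: "coord (e 2) 1 = 0"
    using n_ge_5 by simp
  have pow: "(D ^^ l) ((D ^^ k) (e 2)) = (D ^^ k) ((D ^^ l) (e 2))" for k l
    by (metis add.commute comp_apply funpow_add)
  have "e 1 \<cdot> w = e 1 \<cdot> (\<Sum>l\<le>n - 2. coord w (l + 2) *s (D ^^ l) (e 2))"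
    using expansion_D_pow[OF assms] by simp
  also have "\<dots> = (\<Sum>l\<le>n - 2. coord w (l + 2) *s (D ^^ l) (e 1 \<cdot> e 2))"
    by (simp add: mult_simps e1_mult_D_pow[OF e2])
  also have "\<dots> = (\<Sum>l\<le>n - 2. coord w (l + 2) *s
      (D ^^ l) (\<Sum>k\<le>n - 2. coord (e 1 \<cdot> e 2) (k + 2) *s (D ^^ k) (e 2)))"
    using expansion_D_pow[OF coord_mult_1[OF e2, of "e 1"]] by simp
  also have "\<dots> = (\<Sum>l\<le>n - 2. \<Sum>k\<le>n - 2. coord (e 1 \<cdot> e 2) (k + 2) *s
      (coord w (l + 2) *s (D ^^ k) ((D ^^ l) (e 2))))"
    by (simp add: D_pow_simps scale_sum_right pow mult.commute)
  also have "\<dots> = (\<Sum>k\<le>n - 2. coord (e 1 \<cdot> e 2) (k + 2) *s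
      (D ^^ k) (\<Sum>l\<le>n - 2. coord w (l + 2) *s (D ^^ l) (e 2)))"
    by (subst sum.swap) (simp add: D_pow_simps scale_sum_right)
  also have "(\<Sum>l\<le>n - 2. coord w (l + 2) *s (D ^^ l) (e 2)) = w"
    using expansion_D_pow[OF assms] by simp
  finally show ?thesis .
qed

text \<open>On \<open>W\<close> the map \<open>w \<cdot> _\<close> commutes with \<open>D\<close>,
  hence with multiplication by \<open>e 1\<close>, a polynomial in \<open>D\<close>; so the
  right-hand side of \<open>D_mult_eq\<close> vanishes.\<close>

lemma D_mult_eq_0:
  assumes "coord w 1 = 0" "coord u 1 = 0"
  shows "D (w \<cdot> u) = 0"
proof -
  have "w \<cdot> (e 1 \<cdot> u) = e 1 \<cdot> (w \<cdot> u)"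
    unfolding e1_mult_expansion[OF assms(2)] e1_mult_expansion[OF coord_mult_1[OF assms(2), of w]]
    using assms by (simp add: mult_simps mult_D_pow)
  then show ?thesis
    using D_mult_eq[OF assms] by simp
qed

text \<open>Positive powers of \<open>D\<close> can be pulled out of a product with
  \<open>e 2\<close> and then kill it. What is left is a multiple of \<open>e 2 \<cdot> e 2\<close>,
  which lies in the kernel of \<open>D\<close>.\<close>

lemma mult_e2:
  assumes "coord w 1 = 0"
  shows "e 2 \<cdot> w = (coord w 2 * coord (e 2 \<cdot> e 2) n) *s e n"
proof -
  have e2: "coord (e 2) 1 = 0"
    using n_ge_5 by simp
  have pow: "(D ^^ k) (e 2 \<cdot> e 2) = (if k = 0 then e 2 \<cdot> e 2 else 0)" for k
    by (induction k) (simp_all add: D_mult_eq_0[OF e2 e2])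
  have "e 2 \<cdot> w = e 2 \<cdot> (\<Sum>k\<le>n - 2. coord w (k + 2) *s (D ^^ k) (e 2))"
    using expansion_D_pow[OF assms] by simp
  also have "\<dots> = (\<Sum>k\<le>n - 2. if k = 0 then coord w 2 *s (e 2 \<cdot> e 2) else 0)"
    unfolding mult_simps mult_D_pow[OF e2 e2] pow by (intro sum.cong) auto
  also have "\<dots> = coord w 2 *s (e 2 \<cdot> e 2)"
    by simp
  also have "e 2 \<cdot> e 2 = coord (e 2 \<cdot> e 2) n *s e n"
    by (rule D_eq_0_imp[OF D_mult_eq_0[OF e2 e2] coord_mult_1[OF e2]])
  finally show ?thesis
    by simp
qed

text \<open>Coordinate \<open>j + 2\<close> of \<open>e1_e1_mult\<close> at \<open>e 2\<close>:
  applying the polynomial twice gives the convolution, \<open>D\<close> gives the shift, and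
  \<open>e 2 \<cdot> square_tail\<close> contributes only along \<open>e n\<close>, that is for
  \<open>j = n - 2\<close>.\<close>

lemma e1_mult_coord_convolution:
  assumes "j \<le> n - 2"
  defines "q \<equiv> \<lambda>k. coord (e 1 \<cdot> e 2) (k + 2)"
  shows "(\<Sum>k\<le>j. q k * q (j - k)) = (if 1 \<le> j then q (j - 1) else 0) +
    (if j = n - 2 then coord (e 1 \<cdot> e 1) 2 * coord (e 2 \<cdot> e 2) n else 0)"
proof -
  have j: "1 \<le> j + 2" "j + 2 \<le> n"
    using assms(1) n_ge_5 by linarith+
  have e2: "coord (e 2) 1 = 0"
    using n_ge_5 by simp
  note M = coord_mult_1[OF e2, of "e 1"]
  have "(\<Sum>k\<le>j. q k * q (j - k)) = (\<Sum>k\<le>n - 2. if k \<le> j then q k * q (j - k) else 0)"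
    by (rule sum.mono_neutral_cong_left) (use assms(1) in auto)
  also have "\<dots> = (\<Sum>k\<le>n - 2. q k * coord ((D ^^ k) (e 1 \<cdot> e 2)) (j + 2))"
  proof (intro sum.cong refl)
    fix k
    have "j + 2 - k = j - k + 2" if "k \<le> j"
      using that by arith
    then show "(if k \<le> j then q k * q (j - k) else 0) = q k * coord ((D ^^ k) (e 1 \<cdot> e 2)) (j + 2)"
      unfolding coord_D_pow[OF M j] q_def by simp
  qed
  also have "\<dots> = coord (e 1 \<cdot> (e 1 \<cdot> e 2)) (j + 2)"
    unfolding e1_mult_expansion[OF M] by (simp add: q_def)
  also have "e 1 \<cdot> (e 1 \<cdot> e 2) = D (e 1 \<cdot> e 2) + e 2 \<cdot> square_tail"
    using e1_e1_mult[OF e2] e1_mult_D[OF e2] by (simp add: coord_e1_square_1)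
  also have "coord \<dots> (j + 2) = (if 1 \<le> j then q (j - 1) else 0) +
    (if j = n - 2 then coord (e 1 \<cdot> e 1) 2 * coord (e 2 \<cdot> e 2) n else 0)"
    unfolding coord_add coord_D[OF j] mult_e2[OF coord_square_tail(1)] coord_scale
    using j n_ge_5 by (auto simp: q_def)
  finally show ?thesis .
qed

section \<open>Reading off the parameters\<close>

lemma cpa_eq_filiform_product:
  obtains s \<beta> \<gamma> \<delta> where "s = 0 \<or> s = 1" "\<beta> = (2 * s - 1) * (coord (e 1 \<cdot> e 1) 2 * \<delta>)"
    "mult = filiform_product s (e 1 \<cdot> e 1) \<beta> \<gamma> \<delta>"
proof -
  define q where "q = (\<lambda>k. coord (e 1 \<cdot> e 2) (k + 2))"
  define \<delta> where "\<delta> = coord (e 2 \<cdot> e 2) n"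
  \<comment> \<open>These are the coefficients that \<open>convolution_square_solution\<close> with
    \<open>N = n - 2\<close> does not force to be zero.\<close>
  define s \<beta> \<gamma> where "s = q 1" and "\<beta> = q (n - 3)" and "\<gamma> = q (n - 2)"
  have N: "3 \<le> n - 2" "n - 2 - 1 = n - 3" "n - 2 - 2 = n - 4"
    using n_ge_5 by auto
  have conv: "(\<Sum>k\<le>j. q k * q (j - k)) = (if 1 \<le> j then q (j - 1) else 0) +
      (if j = n - 2 then coord (e 1 \<cdot> e 1) 2 * \<delta> else 0)" if "j \<le> n - 2" for j
    unfolding q_def \<delta>_def by (rule e1_mult_coord_convolution[OF that])
  note q = convolution_square_solution[OF N(1) conv, unfolded N(2,3)]
  have s: "s = 0 \<or> s = 1"
    using q(2) by (simp add: s_def)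
  \<comment> \<open>The factor \<open>2 * s - 1\<close> is its own inverse, which solves the
    relation for \<open>\<beta>\<close>.\<close>
  have "\<beta> = (2 * s - 1) * ((2 * s - 1) * \<beta>)"
    using s by (elim disjE) simp_all
  also have "(2 * s - 1) * \<beta> = coord (e 1 \<cdot> e 1) 2 * \<delta>"
    using q(4) by (simp add: s_def \<beta>_def)
  finally have \<beta>: "\<beta> = (2 * s - 1) * (coord (e 1 \<cdot> e 1) 2 * \<delta>)" .
  have e2: "coord (e 2) 1 = 0"
    using n_ge_5 by simp
  have M_e2: "e 1 \<cdot> e 2 = Q s \<beta> \<gamma> (e 2)"
  proof (rule coord_eqI)
    fix i assume i: "1 \<le> i" "i \<le> n"
    have q_coord: "coord (e 1 \<cdot> e 2) i = q (i - 2)" if "2 \<le> i"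
      using that by (simp add: q_def)
    consider "i = 1" | "i = 2" | "i = 3" | "4 \<le> i" "i \<le> n - 2" | "i = n - 1" | "i = n"
      using i by linarith
    then show "coord (e 1 \<cdot> e 2) i = coord (Q s \<beta> \<gamma> (e 2)) i"
    proof cases
      case 1
      then show ?thesis
        using coord_mult_1[OF e2, of "e 1"] by simp
    next
      case 2
      then show ?thesis
        using q_coord q(1) by simp
    next
      case 3
      then show ?thesis
        using q_coord n_ge_5 by (simp add: s_def One_nat_def)
    next
      case 4
      then have "q (i - 2) = 0"
        by (intro q(3)) auto
      then show ?thesis
        using 4 q_coord n_ge_5 by (auto simp: Q_basis)
    next
      case 5
      then have "i - 2 = n - 3"
        by simp
      then show ?thesis
        using 5 q_coord n_ge_5 by (auto simp: Q_basis \<beta>_def)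
    next
      case 6
      then show ?thesis
        using q_coord n_ge_5 by (auto simp: Q_basis \<gamma>_def)
    qed
  qed
  \<comment> \<open>Both maps commute with \<open>D\<close>, which carries \<open>e 2\<close>
    successively to the later basis vectors, so agreement at \<open>e 2\<close> propagates.\<close>
  have M_e: "e 1 \<cdot> e i = Q s \<beta> \<gamma> (e i)" if "2 \<le> i" "i \<le> n" for i
    using that
  proof (induction i rule: dec_induct)
    case base
    show ?case
      by (rule M_e2)
  next
    case (step i)
    then have "D (e i) = e (Suc i)"
      by (simp add: D_basis Suc_eq_plus1)
    moreover have "e 1 \<cdot> D (e i) = Q s \<beta> \<gamma> (D (e i))"
      using step by (simp add: e1_mult_D coord_e1_square_1 Q_D)
    ultimately show ?case
      by simp
  qed
  have "mult = filiform_product s (e 1 \<cdot> e 1) \<beta> \<gamma> \<delta>"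
  proof (rule bilinear_commutative_eqI[OF mult_bilinear filiform_product_bilinear mult_commute
        filiform_product_commute])
    fix i j assume ij: "1 \<le> i" "i \<le> j" "j \<le> n"
    consider "i = 1" "j = 1" | "i = 1" "2 \<le> j" | "i = 2" | "3 \<le> i"
      using ij by linarith
    then show "e i \<cdot> e j = filiform_product s (e 1 \<cdot> e 1) \<beta> \<gamma> \<delta> (e i) (e j)"
    proof cases
      case 1
      then show ?thesis
        using n_ge_5 by (simp add: filiform_product_def Q_basis)
    next
      case 2
      then show ?thesis
        using ij M_e[of j] n_ge_5 by (simp add: filiform_product_def)
    next
      case 3
      then show ?thesis
        using ij mult_e2[of "e j"] by (auto simp: filiform_product_def \<delta>_def)
    next
      case 4
      \<comment> \<open>Since \<open>3 \<le> j\<close>, the vector \<open>e j\<close> is the image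
        under \<open>D\<close> of an element of \<open>W\<close>, so its product with any element of
        \<open>W\<close> is zero.\<close>
      then have "1 \<le> j - 1" "j - 1 \<le> n" "2 \<le> j - 1" "j - 1 < n" "j - 1 + 1 = j"
        using ij by linarith+
      then have "e j = D (e (j - 1))"
        by (simp add: D_basis)
      then have "e i \<cdot> e j = 0"
        using D_mult[of "e (j - 1)" "e i"] D_mult_eq_0[of "e i" "e (j - 1)"] 4 ij by simp
      then show ?thesis
        using 4 ij n_ge_5 by (auto simp: filiform_product_def)
    qed
  qed
  with s \<beta> show ?thesis
    by (rule that)
qed

end

section \<open>The two types of CPA-structures\<close>

lemma sum_basis_tail:
  assumes "coord a 1 = 0"
  shows "(\<Sum>k=2..n. coord a k *s e k) = a"
  using basis_expansion[of a] assms n_ge_5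
  by (simp add: sum.atLeast_Suc_atMost[of 1 n] flip: Suc_1)

lemma coord_sum_tail:
  "coord (\<Sum>k=2..n. \<alpha> k *s e k) 1 = 0" "coord (\<Sum>k=2..n. \<alpha> k *s e k) 2 = \<alpha> 2"
proof -
  show "coord (\<Sum>k=2..n. \<alpha> k *s e k) 1 = 0"
    unfolding coord_sum using n_ge_5 by (intro sum.neutral) auto
  have "coord (\<Sum>k=2..n. \<alpha> k *s e k) 2 = (\<Sum>k=2..n. if k = 2 then \<alpha> k else 0)"
    unfolding coord_sum by (intro sum.cong refl) (use n_ge_5 in auto)
  then show "coord (\<Sum>k=2..n. \<alpha> k *s e k) 2 = \<alpha> 2"
    using n_ge_5 by simp
qed

lemma cpa_classification:
  assumes "cpa_structure scale bracket mult"
  shows "(\<exists>\<alpha> \<beta> \<gamma> \<delta>. \<alpha> 2 * \<delta> + \<beta> = 0 \<and> mult = type1_product scale n e \<alpha> \<beta> \<gamma> \<delta>) \<or>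
    (\<exists>\<alpha> \<beta> \<gamma> \<delta>. \<alpha> 2 * \<delta> - \<beta> = 0 \<and> mult = type2_product scale n e \<alpha> \<beta> \<gamma> \<delta>)"
proof -
  define a where "a = mult (e 1) (e 1)"
  obtain s \<beta> \<gamma> \<delta> where s: "s = 0 \<or> s = 1" and \<beta>: "\<beta> = (2 * s - 1) * (coord a 2 * \<delta>)"
    and mult: "mult = filiform_product s a \<beta> \<gamma> \<delta>"
    by (rule cpa_eq_filiform_product[OF assms, folded a_def])
  have a: "(\<Sum>k=2..n. coord a k *s e k) = a"
    using coord_e1_square_1[OF assms] unfolding a_def by (rule sum_basis_tail)
  from s show ?thesis
  proof
    assume "s = 0"
    then have "coord a 2 * \<delta> + \<beta> = 0" "mult = type1_product scale n e (coord a) \<beta> \<gamma> \<delta>"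
      using \<beta> mult by (simp_all add: type1_product_eq a)
    then show ?thesis
      by blast
  next
    assume "s = 1"
    then have "coord a 2 * \<delta> - \<beta> = 0" "mult = type2_product scale n e (coord a) \<beta> \<gamma> \<delta>"
      using \<beta> mult by (simp_all add: type2_product_eq a)
    then show ?thesis
      by blast
  qed
qed

lemma type1_cpa:
  assumes "\<alpha> 2 * \<delta> + \<beta> = 0"
  shows "cpa_structure scale bracket (type1_product scale n e \<alpha> \<beta> \<gamma> \<delta>)"
  unfolding type1_product_eq
  by (rule filiform_product_cpa) (use assms in \<open>simp_all add: coord_sum_tail eq_neg_iff_add_eq_0 add.commute del: coord_sum\<close>)

lemma type2_cpa:
  assumes "\<alpha> 2 * \<delta> - \<beta> = 0"
  shows "cpa_structure scale bracket (type2_product scale n e \<alpha> \<beta> \<gamma> \<delta>)"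
  unfolding type2_product_eq
  by (rule filiform_product_cpa) (use assms in \<open>simp_all add: coord_sum_tail del: coord_sum\<close>)

lemma type1_product_derived:
  "product_span scale (type1_product scale n e \<alpha> \<beta> \<gamma> \<delta>)
     (derived_algebra scale bracket) (derived_algebra scale bracket) = {0}"
  unfolding type1_product_eq by (rule filiform_product_derived)

lemma type2_product_derived:
  "product_span scale (type2_product scale n e \<alpha> \<beta> \<gamma> \<delta>)
     (derived_algebra scale bracket) (derived_algebra scale bracket) = {0}"
  unfolding type2_product_eq by (rule filiform_product_derived)

lemma type1_derived_ne_0:
  assumes "\<beta> \<noteq> 0"
  shows "product_span scale (type1_product scale n e \<alpha> \<beta> \<gamma> \<delta>) UNIV (derived_algebra scale bracket) \<noteq> {0}"
proof (rule product_span_derived_ne_0)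
  have "coord (type1_product scale n e \<alpha> \<beta> \<gamma> \<delta> (e 1) (e 3)) n = \<beta>"
    using n_ge_5 by (simp add: type1_product_eq filiform_product_def Q_basis)
  with assms show "type1_product scale n e \<alpha> \<beta> \<gamma> \<delta> (e 1) (e 3) \<noteq> 0"
    by force
qed

text \<open>For all parameters \<open>e 1 \<cdot> e 3\<close> has the summand \<open>e 4\<close>,
  which \<open>\<beta> *s e n\<close> cannot cancel because \<open>5 \<le> n\<close>.\<close>

lemma type2_derived_ne_0:
  "product_span scale (type2_product scale n e \<alpha> \<beta> \<gamma> \<delta>) UNIV (derived_algebra scale bracket) \<noteq> {0}"
proof (rule product_span_derived_ne_0)
  have "coord (type2_product scale n e \<alpha> \<beta> \<gamma> \<delta> (e 1) (e 3)) 4 = 1"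
    using n_ge_5 by (simp add: type2_product_eq filiform_product_def Q_basis)
  then show "type2_product scale n e \<alpha> \<beta> \<gamma> \<delta> (e 1) (e 3) \<noteq> 0"
    by force
qed

end

theorem proposition3p10:
  fixes scale :: "complex \<Rightarrow> 'v::ab_group_add \<Rightarrow> 'v"
    and bracket :: "'v \<Rightarrow> 'v \<Rightarrow> 'v"
    and n :: nat
    and e :: "nat \<Rightarrow> 'v"
  assumes "n \<ge> 5"
    and "standard_filiform scale bracket n e"
  shows "(\<forall>mult. cpa_structure scale bracket mult \<longrightarrow>
             (\<exists>\<alpha> \<beta> \<gamma> \<delta>. \<alpha> 2 * \<delta> + \<beta> = 0 \<and> mult = type1_product scale n e \<alpha> \<beta> \<gamma> \<delta>) \<or>
             (\<exists>\<alpha> \<beta> \<gamma> \<delta>. \<alpha> 2 * \<delta> - \<beta> = 0 \<and> mult = type2_product scale n e \<alpha> \<beta> \<gamma> \<delta>))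
       \<and> (\<forall>\<alpha> \<beta> \<gamma> \<delta>. \<alpha> 2 * \<delta> + \<beta> = 0 \<longrightarrow>
             cpa_structure scale bracket (type1_product scale n e \<alpha> \<beta> \<gamma> \<delta>) \<and>
             product_span scale (type1_product scale n e \<alpha> \<beta> \<gamma> \<delta>)
               (derived_algebra scale bracket) (derived_algebra scale bracket) = {0})
       \<and> (\<forall>\<alpha> \<beta> \<gamma> \<delta>. \<alpha> 2 * \<delta> - \<beta> = 0 \<longrightarrow>
             cpa_structure scale bracket (type2_product scale n e \<alpha> \<beta> \<gamma> \<delta>) \<and>
             product_span scale (type2_product scale n e \<alpha> \<beta> \<gamma> \<delta>)
               (derived_algebra scale bracket) (derived_algebra scale bracket) = {0})
       \<and> (\<exists>\<alpha> \<beta> \<gamma> \<delta>. \<alpha> 2 * \<delta> + \<beta> = 0 \<and>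
             product_span scale (type1_product scale n e \<alpha> \<beta> \<gamma> \<delta>)
               UNIV (derived_algebra scale bracket) \<noteq> {0})
       \<and> (\<exists>\<alpha> \<beta> \<gamma> \<delta>. \<alpha> 2 * \<delta> - \<beta> = 0 \<and>
             product_span scale (type2_product scale n e \<alpha> \<beta> \<gamma> \<delta>)
               UNIV (derived_algebra scale bracket) \<noteq> {0})"
proof -
  interpret long_filiform scale bracket n e
    using assms by (simp add: long_filiform_def long_filiform_axioms_def)
  \<comment> \<open>A nonzero \<open>\<beta>\<close> is wanted, and the constraint then forces
    \<open>\<alpha> 2\<close> and \<open>\<delta>\<close> to be nonzero as well.\<close>
  have 1: "\<exists>\<alpha> \<beta> \<gamma> \<delta>. \<alpha> 2 * \<delta> + \<beta> = 0 \<and>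
      product_span scale (type1_product scale n e \<alpha> \<beta> \<gamma> \<delta>) UNIV (derived_algebra scale bracket) \<noteq> {0}"
    using type1_derived_ne_0[of 1]
    by (intro exI[of _ "\<lambda>_. 1"] exI[of _ 1] exI[of _ 0] exI[of _ "- 1"]) simp
  have 2: "\<exists>\<alpha> \<beta> \<gamma> \<delta>. \<alpha> 2 * \<delta> - \<beta> = 0 \<and>
      product_span scale (type2_product scale n e \<alpha> \<beta> \<gamma> \<delta>) UNIV (derived_algebra scale bracket) \<noteq> {0}"
    using type2_derived_ne_0 by (intro exI[of _ "\<lambda>_. 0"] exI[of _ 0]) simp
  show ?thesis
    by (intro conjI allI impI cpa_classification type1_cpa type2_cpa type1_product_derived
        type2_product_derived 1 2)
qed

end
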